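(* Let $(V,E)$ be a finite connected graph, $a_0,a_1\in V$ two distinct vertices, $\omega>0$, $\lambda=i\omega$, and for each edge $xy$ let $R_{xy},L_{xy},D_{xy}\ge 0$ with $R_{xy}^2+L_{xy}^2+D_{xy}^2\ne0$, impedance $z_{xy}=R_{xy}+L_{xy}i\omega+\dfrac{D_{xy}}{i\omega}\neq0$ and admittance $\rho_{xy}=1/z_{xy}$ (and $\rho_{xy}=0$ if $xy\notin E$). Define the effective impedance $Z_{eff}\in\mathbb{C}\cup\{\infty\}$ as follows: if the Dirichlet problem $$\sum_{y\in V}(v(y)-v(x))\rho_{xy}=0\ (x\in V\setminus\{a_0,a_1\}),\quad v(a_0)=0,\quad v(a_1)=1$$ has no solution $v:V\to\mathbb{C}$, then $Z_{eff}=0$; otherwise $Z_{eff}=1/\sum_{x:x\sim a_0}v(x)\rho_{xa_0}$ for a solution $v$ (this value does not depend on the choice of solution). Then, when $Z_{eff}\in\mathbb{C}$, $\Re(Z_{eff})\ge0$. Moreover, if $\Im(z_{xy})\le 0$ for every $xy\in E$, then $\Im(Z_{eff})\le0$, and if $\Im(z_{xy})\ge0$ for every $xy\in E$, then $\Im(Z_{eff})\ge0$.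
   Context: $R_{xy},L_{xy},D_{xy}$ are resistance, inductance and inverse capacitance of the edge. $x\sim a_0$ means $x$ is adjacent to $a_0$. *)

theory Defs
  imports Complex_Main "Graph_Theory.Digraph_Component"
begin

text \<open>
  A finite simple graph is a \<open>pair_graph\<close>: its arc relation \<open>parcs G\<close> is symmetric and
  irreflexive, each edge \<open>xy\<close> being represented by the two arcs \<open>(x, y)\<close> and \<open>(y, x)\<close>.
  Edge quantities are indexed by the unordered pair \<open>{x, y}\<close>, so that they do not depend
  on the orientation.
\<close>

definition edge_set :: "'a pair_pre_digraph \<Rightarrow> 'a set set" where
  "edge_set G = {{x, y} | x y. (x, y) \<in> parcs G}"

definition impedance ::
  "('a set \<Rightarrow> real) \<Rightarrow> ('a set \<Rightarrow> real) \<Rightarrow> ('a set \<Rightarrow> real) \<Rightarrow> real \<Rightarrow> 'a set \<Rightarrow> complex" where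
  "impedance R L D \<omega> e =
     complex_of_real (R e) + complex_of_real (L e) * (\<i> * complex_of_real \<omega>)
       + complex_of_real (D e) / (\<i> * complex_of_real \<omega>)"

definition admittance :: "'a pair_pre_digraph \<Rightarrow> ('a set \<Rightarrow> complex) \<Rightarrow> 'a \<Rightarrow> 'a \<Rightarrow> complex" where
  "admittance G z x y = (if {x, y} \<in> edge_set G then 1 / z {x, y} else 0)"

text \<open>Values of \<open>v\<close> outside \<open>pverts G\<close> are irrelevant.\<close>

definition dirichlet_solution ::
  "'a pair_pre_digraph \<Rightarrow> ('a set \<Rightarrow> complex) \<Rightarrow> 'a \<Rightarrow> 'a \<Rightarrow> ('a \<Rightarrow> complex) \<Rightarrow> bool" where
  "dirichlet_solution G z a0 a1 v \<longleftrightarrow>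
     (\<forall>x \<in> pverts G - {a0, a1}. (\<Sum>y\<in>pverts G. (v y - v x) * admittance G z x y) = 0) \<and>
     v a0 = 0 \<and> v a1 = 1"

definition total_current ::
  "'a pair_pre_digraph \<Rightarrow> ('a set \<Rightarrow> complex) \<Rightarrow> 'a \<Rightarrow> ('a \<Rightarrow> complex) \<Rightarrow> complex" where
  "total_current G z a0 v =
     (\<Sum>x \<in> {x \<in> pverts G. {x, a0} \<in> edge_set G}. v x * admittance G z x a0)"

text \<open>The set \<open>\<complex> \<union> {\<infinity>}\<close>.\<close>

datatype ext_complex = Fin complex | Infty

text \<open>
  The case distinction on zero current is needed because \<open>1 / 0 = 0\<close> in HOL, whereas
  here \<open>1 / 0\<close> means \<open>\<infinity>\<close>. By \<open>total_current_unique\<close> below, the choice of the solution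
  does not matter.
\<close>

definition effective_impedance ::
  "'a pair_pre_digraph \<Rightarrow> ('a set \<Rightarrow> complex) \<Rightarrow> 'a \<Rightarrow> 'a \<Rightarrow> ext_complex" where
  "effective_impedance G z a0 a1 =
     (if \<nexists>v. dirichlet_solution G z a0 a1 v then Fin 0
      else let c = total_current G z a0 (SOME v. dirichlet_solution G z a0 a1 v)
           in if c = 0 then Infty else Fin (1 / c))"

lemma admittance_commute: "admittance G z x y = admittance G z y x"
  by (simp add: admittance_def insert_commute)

lemma total_current_alt:
  assumes "finite (pverts G)" "v a0 = 0"
  shows "total_current G z a0 v = (\<Sum>y\<in>pverts G. (v y - v a0) * admittance G z a0 y)"
proof -
  have "total_current G z a0 v = (\<Sum>y\<in>pverts G. v y * admittance G z y a0)"
    unfolding total_current_def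
    by (rule sum.mono_neutral_left) (use assms in \<open>auto simp: admittance_def\<close>)
  also have "\<dots> = (\<Sum>y\<in>pverts G. (v y - v a0) * admittance G z a0 y)"
    using assms(2) by (simp add: admittance_commute[of G z a0])
  finally show ?thesis .
qed

lemma green_symmetric:
  fixes u v :: "'a \<Rightarrow> complex"
  shows "(\<Sum>x\<in>pverts G. u x * (\<Sum>y\<in>pverts G. (v y - v x) * admittance G z x y)) =
         (\<Sum>x\<in>pverts G. v x * (\<Sum>y\<in>pverts G. (u y - u x) * admittance G z x y))"
proof -
  let ?V = "pverts G" and ?r = "admittance G z"
  have "(\<Sum>x\<in>?V. \<Sum>y\<in>?V. u x * v y * ?r x y) = (\<Sum>y\<in>?V. \<Sum>x\<in>?V. u x * v y * ?r x y)"
    by (rule sum.swap)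
  also have "\<dots> = (\<Sum>x\<in>?V. \<Sum>y\<in>?V. v x * u y * ?r x y)"
    by (intro sum.cong refl) (simp add: admittance_commute mult.commute)
  finally show ?thesis
    by (simp add: sum_distrib_left algebra_simps sum_subtractf)
qed

theorem total_current_unique:
  assumes "finite (pverts G)" "a0 \<in> pverts G" "a1 \<in> pverts G" "a0 \<noteq> a1"
    and "dirichlet_solution G z a0 a1 v" "dirichlet_solution G z a0 a1 w"
  shows "total_current G z a0 v = total_current G z a0 w"
proof -
  let ?V = "pverts G"
  define lap where "lap f x = (\<Sum>y\<in>?V. (f y - f x) * admittance G z x y)" for f x
  have sup: "(\<Sum>x\<in>?V. u x * lap f x) = u a0 * lap f a0 + u a1 * lap f a1"
    if "dirichlet_solution G z a0 a1 f" for u f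
  proof -
    have "(\<Sum>x\<in>?V. u x * lap f x) = (\<Sum>x\<in>{a0, a1}. u x * lap f x)"
      by (rule sum.mono_neutral_right)
        (use assms that in \<open>auto simp: dirichlet_solution_def lap_def\<close>)
    then show ?thesis using assms(4) by simp
  qed
  have bal: "lap f a0 = - lap f a1" if f: "dirichlet_solution G z a0 a1 f" for f
  proof -
    have "(\<Sum>x\<in>?V. 1 * lap f x) = 0"
      unfolding lap_def using green_symmetric[of "\<lambda>_. 1" f G z] by simp
    then show ?thesis unfolding sup[OF f, of "\<lambda>_. 1"] by (simp add: eq_neg_iff_add_eq_0)
  qed
  have bc: "v a0 = 0" "v a1 = 1" "w a0 = 0" "w a1 = 1"
    using assms(5,6) by (auto simp: dirichlet_solution_def)
  have "(\<Sum>x\<in>?V. w x * lap v x) = (\<Sum>x\<in>?V. v x * lap w x)"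
    unfolding lap_def by (rule green_symmetric)
  then have "lap v a1 = lap w a1"
    by (simp add: sup assms(5,6) bc)
  then have "lap v a0 = lap w a0"
    by (simp add: bal assms(5,6))
  then show ?thesis
    by (simp add: total_current_alt assms(1) bc lap_def)
qed

end

(*
  Pairing a Dirichlet solution v with its complex conjugate in Green's formula shows that the
  total current, i.e. the effective admittance, is half the sum of |v(y) - v(x)|^2 * rho_xy
  over all ordered pairs: a nonnegative combination of the edge admittances. Closed half-planes
  bounded by an axis are preserved by such combinations, and inversion keeps the sign of the
  real part and flips the sign of the imaginary part.
*)
theory Submission
  imports Defs
begin

lemma Re_one_divide: "Re (1 / w) = Re w / (cmod w)\<^sup>2"
  by (simp add: Re_divide cmod_power2)

lemma Im_one_divide: "Im (1 / w) = - Im w / (cmod w)\<^sup>2"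
  by (simp add: Im_divide cmod_power2)

lemma Re_impedance: "Re (impedance R L D \<omega> e) = R e"
  by (simp add: impedance_def Re_divide)

text \<open>Summation by parts: exchanging the roles of x and y, which the symmetric admittance
  permits, gives a second form of the left-hand double sum, and adding the two forms produces the
  product of differences. No boundary values enter, so u stays free as a test function.\<close>

lemma green_energy:
  fixes u v :: "'a \<Rightarrow> complex"
  shows "2 * (\<Sum>x\<in>pverts G. u x * (\<Sum>y\<in>pverts G. (v y - v x) * admittance G z x y)) =
         - (\<Sum>x\<in>pverts G. \<Sum>y\<in>pverts G. (u y - u x) * (v y - v x) * admittance G z x y)"
proof -
  let ?V = "pverts G" and ?r = "admittance G z"
  let ?S = "\<Sum>x\<in>?V. \<Sum>y\<in>?V. u x * (v y - v x) * ?r x y"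
  have "?S = (\<Sum>y\<in>?V. \<Sum>x\<in>?V. u x * (v y - v x) * ?r x y)"
    by (rule sum.swap)
  also have "\<dots> = (\<Sum>x\<in>?V. \<Sum>y\<in>?V. u y * (v x - v y) * ?r x y)"
    by (simp add: admittance_commute)
  finally have "2 * ?S = ?S + (\<Sum>x\<in>?V. \<Sum>y\<in>?V. u y * (v x - v y) * ?r x y)"
    by simp
  also have "\<dots> = - (\<Sum>x\<in>?V. \<Sum>y\<in>?V. (u y - u x) * (v y - v x) * ?r x y)"
    by (simp add: sum.distrib[symmetric] sum_negf[symmetric] algebra_simps)
  finally show ?thesis
    by (simp add: sum_distrib_left mult.assoc)
qed

lemma total_current_energy:
  assumes "finite (pverts G)" "a0 \<in> pverts G" "a1 \<in> pverts G" "a0 \<noteq> a1"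
    and v: "dirichlet_solution G z a0 a1 v"
  shows "total_current G z a0 v =
    (\<Sum>x\<in>pverts G. \<Sum>y\<in>pverts G. of_real ((cmod (v y - v x))\<^sup>2 / 2) * admittance G z x y)"
proof -
  let ?V = "pverts G"
  define lap where "lap x = (\<Sum>y\<in>?V. (v y - v x) * admittance G z x y)" for x
  have bc: "v a0 = 0" "v a1 = 1"
    using v by (auto simp: dirichlet_solution_def)
  \<comment> \<open>The Dirichlet equations make \<open>lap\<close> vanish away from the two
    terminals.\<close>
  have sup: "(\<Sum>x\<in>?V. u x * lap x) = u a0 * lap a0 + u a1 * lap a1" for u
  proof -
    have "(\<Sum>x\<in>?V. u x * lap x) = (\<Sum>x\<in>{a0, a1}. u x * lap x)"
      by (rule sum.mono_neutral_right)
        (use assms in \<open>auto simp: dirichlet_solution_def lap_def\<close>)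
    then show ?thesis using assms(4) by simp
  qed
  have energy: "2 * (u a0 * lap a0 + u a1 * lap a1) =
      - (\<Sum>x\<in>?V. \<Sum>y\<in>?V. (u y - u x) * (v y - v x) * admittance G z x y)" for u
    using green_energy[of u v G z] unfolding lap_def[symmetric] sup .
  \<comment> \<open>A constant test function has no differences; this is conservation of current
    between the terminals.\<close>
  have "2 * (lap a0 + lap a1) = 0"
    using energy[of "\<lambda>_. 1"] by simp
  then have "lap a0 = - lap a1"
    unfolding mult_eq_0_iff by (simp add: eq_neg_iff_add_eq_0)
  \<comment> \<open>The conjugate of v is 0 at \<open>a0\<close> and 1 at \<open>a1\<close>, so only
    \<open>lap a1\<close> survives. Conjugating one factor turns the complex square of each
    difference into a squared modulus, hence a nonnegative real weight.\<close>
  moreover have "2 * lap a1 =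
      - (\<Sum>x\<in>?V. \<Sum>y\<in>?V. (cnj (v y) - cnj (v x)) * (v y - v x) * admittance G z x y)"
    using energy[of "\<lambda>x. cnj (v x)"] by (simp add: bc)
  moreover have "(cnj (v y) - cnj (v x)) * (v y - v x) = 2 * of_real ((cmod (v y - v x))\<^sup>2 / 2)" for x y
    using complex_norm_square[of "v y - v x"] by (simp add: mult.commute)
  ultimately have "2 * lap a0 =
      2 * (\<Sum>x\<in>?V. \<Sum>y\<in>?V. of_real ((cmod (v y - v x))\<^sup>2 / 2) * admittance G z x y)"
    by (simp add: sum_distrib_left mult.assoc)
  then show ?thesis
    by (simp add: total_current_alt assms(1) bc lap_def)
qed

theorem theorem2p10:
  fixes G :: "'a pair_pre_digraph"
    and a0 a1 :: 'a
    and \<omega> :: real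
    and R L D :: "'a set \<Rightarrow> real"
    and z :: "'a set \<Rightarrow> complex"
    and Z :: complex
  assumes "pair_graph G"
    and "Digraph_Component.connected (with_proj G)"
    and "a0 \<in> pverts G" and "a1 \<in> pverts G" and "a0 \<noteq> a1"
    and "\<omega> > 0"
    and "\<forall>e \<in> edge_set G. R e \<ge> 0 \<and> L e \<ge> 0 \<and> D e \<ge> 0"
    and "\<forall>e \<in> edge_set G. (R e)\<^sup>2 + (L e)\<^sup>2 + (D e)\<^sup>2 \<noteq> 0"
    and "\<forall>e \<in> edge_set G. z e = impedance R L D \<omega> e"
    and "\<forall>e \<in> edge_set G. z e \<noteq> 0"
    and "effective_impedance G z a0 a1 = Fin Z"
  shows "Re Z \<ge> 0 \<and>
         ((\<forall>e \<in> edge_set G. Im (z e) \<le> 0) \<longrightarrow> Im Z \<le> 0) \<and>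
         ((\<forall>e \<in> edge_set G. Im (z e) \<ge> 0) \<longrightarrow> Im Z \<ge> 0)"
proof -
  interpret pair_graph G by fact
  show ?thesis
  proof (cases "\<exists>v. dirichlet_solution G z a0 a1 v")
    case False
    then show ?thesis
      using assms(11) by (simp add: effective_impedance_def)
  next
    case True
    define v where "v = (SOME v. dirichlet_solution G z a0 a1 v)"
    define c where "c = total_current G z a0 v"
    have sol: "dirichlet_solution G z a0 a1 v"
      unfolding v_def using True by (rule someI_ex)
    \<comment> \<open>A finite value rules out c = 0, which would give \<open>Infty\<close>.\<close>
    have Z: "Z = 1 / c"
      using assms(11) True
      by (auto simp: effective_impedance_def c_def v_def Let_def split: if_splits)
    have c: "c = (\<Sum>x\<in>pverts G. \<Sum>y\<in>pverts G.
        of_real ((cmod (v y - v x))\<^sup>2 / 2) * admittance G z x y)"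
      unfolding c_def using assms sol by (intro total_current_energy) auto
    \<comment> \<open>On an edge the real part of the impedance is the resistance; off the edges the
      admittance is 0.\<close>
    have Re: "0 \<le> Re (admittance G z x y)" for x y
      using assms(7,9) by (auto simp: admittance_def Re_one_divide Re_impedance)
    have "0 \<le> Re c"
      unfolding c by (auto intro!: sum_nonneg mult_nonneg_nonneg Re)
    \<comment> \<open>The sign flips here, from z to the admittances, and flips back on passing from
      c to Z = 1 / c.\<close>
    moreover have "0 \<le> Im c" if "\<forall>e \<in> edge_set G. Im (z e) \<le> 0"
    proof -
      have "0 \<le> Im (admittance G z x y)" for x y
        using that by (auto simp: admittance_def Im_one_divide divide_nonpos_nonneg)
      then show ?thesis
        unfolding c by (auto intro!: sum_nonneg mult_nonneg_nonneg)
    qed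
    moreover have "Im c \<le> 0" if "\<forall>e \<in> edge_set G. 0 \<le> Im (z e)"
    proof -
      have "Im (admittance G z x y) \<le> 0" for x y
        using that by (auto simp: admittance_def Im_one_divide)
      then show ?thesis
        unfolding c by (auto intro!: sum_nonpos mult_nonneg_nonpos)
    qed
    ultimately show ?thesis
      unfolding Z by (auto simp: Re_one_divide Im_one_divide divide_nonpos_nonneg)
  qed
qed

end
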